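(* Any (possibly randomized) algorithm for the 2-coloring problem has average sensitivity $\Omega(n)$; that is, there is an absolute constant $c>0$ such that for every such algorithm $\mathcal{A}$ and for infinitely many $n$, there is a bipartite graph $G$ on $n$ vertices with $\mathbb{E}_{e\sim E}[d_{\mathrm{EM}}(\mathcal{A}(G),\mathcal{A}(G-e))]\ge cn$.
   Context: 2-coloring problem: given a bipartite graph $G=(V,E)$ with $n=|V|$, output a proper 2-coloring $f:V\to\{0,1\}$ (i.e. $f(u)\ne f(v)$ for all $(u,v)\in E$); equivalently one part $f^{-1}(1)$ of a bipartition. The distance between two colorings is the Hamming distance (number of vertices colored differently). For a randomized algorithm with output distribution $\mathcal{A}(G)$, $d_{\mathrm{EM}}$ is the earth mover's distance with respect to this Hamming distance; $e$ is uniform in $E$ and $G-e$ is $G$ with $e$ deleted. *)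

theory Defs
  imports "HOL-Probability.Probability"
begin

definition simple_graph :: "nat set \<Rightarrow> nat set set \<Rightarrow> bool" where
  "simple_graph V E \<longleftrightarrow> finite V \<and> (\<forall>e\<in>E. e \<subseteq> V \<and> card e = 2)"

definition bipartite_graph :: "nat set \<Rightarrow> nat set set \<Rightarrow> bool" where
  "bipartite_graph V E \<longleftrightarrow> simple_graph V E \<and>
     (\<exists>X Y. X \<union> Y = V \<and> X \<inter> Y = {} \<and> (\<forall>e\<in>E. \<exists>x\<in>X. \<exists>y\<in>Y. e = {x, y}))"

definition proper_2_coloring :: "nat set \<Rightarrow> nat set set \<Rightarrow> (nat \<Rightarrow> nat) \<Rightarrow> bool" where
  "proper_2_coloring V E f \<longleftrightarrow>
     f \<in> V \<rightarrow>\<^sub>E {0, 1} \<and> (\<forall>u v. {u, v} \<in> E \<longrightarrow> f u \<noteq> f v)"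

definition hamming_dist :: "nat set \<Rightarrow> (nat \<Rightarrow> nat) \<Rightarrow> (nat \<Rightarrow> nat) \<Rightarrow> nat" where
  "hamming_dist V f g = card {v \<in> V. f v \<noteq> g v}"

definition couplings :: "'a pmf \<Rightarrow> 'b pmf \<Rightarrow> ('a \<times> 'b) pmf set" where
  "couplings p q = {r. map_pmf fst r = p \<and> map_pmf snd r = q}"

(* Real-valued, hence only meaningful for costs that are integrable under every coupling;
   the Hamming distance is bounded by the number of vertices. *)
definition earth_movers_dist :: "('a \<Rightarrow> 'a \<Rightarrow> real) \<Rightarrow> 'a pmf \<Rightarrow> 'a pmf \<Rightarrow> real" where
  "earth_movers_dist d p q =
     (INF r\<in>couplings p q. measure_pmf.expectation r (\<lambda>(x, y). d x y))"

(* A randomized algorithm is identified with the map from inputs to output distributions.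
   There are only finitely many colorings of a given graph, so a pmf loses no generality.
   Nothing is assumed about the output on inputs that are not bipartite graphs. *)
definition two_coloring_algorithm ::
    "(nat set \<Rightarrow> nat set set \<Rightarrow> (nat \<Rightarrow> nat) pmf) \<Rightarrow> bool" where
  "two_coloring_algorithm A \<longleftrightarrow>
     (\<forall>V E. bipartite_graph V E \<longrightarrow> (\<forall>f\<in>set_pmf (A V E). proper_2_coloring V E f))"

(* Only meaningful for finite nonempty E, because of pmf_of_set. *)
definition average_sensitivity ::
    "(nat set \<Rightarrow> nat set set \<Rightarrow> (nat \<Rightarrow> nat) pmf) \<Rightarrow> nat set \<Rightarrow> nat set set \<Rightarrow> real" where
  "average_sensitivity A V E =
     measure_pmf.expectation (pmf_of_set E)
       (\<lambda>e. earth_movers_dist (\<lambda>f g. real (hamming_dist V f g)) (A V E) (A V (E - {e})))"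

end

theory Submission
  imports Defs
begin

text \<open>
  Average over all Hamiltonian paths on \<open>n\<close> vertices, \<open>n\<close> even. Deleting a middle edge of a path at
  an even position leaves two segments of even length. Reversing the second segment and reattaching
  it gives another path with the same edge-deleted graph. Since the ends of the reversed segment
  have opposite colors, the relative colorings of the two segments forced by the two paths are
  opposite, so every coloring of the common edge-deleted graph is far from all colorings of one of
  the two paths.
\<close>

section \<open>Lower bounds on the earth mover's distance\<close>

text \<open>A Markov-type bound: whatever the coupling, the pairs with second component in
  \<open>S\<close> carry the mass that \<open>q\<close> gives to \<open>S\<close>, and each costs at
  least \<open>M\<close>; all other pairs cost at least 0. Finite supports make the real-valued
  expectations integrable.\<close>

lemma earth_movers_dist_ge_prob:
  fixes d :: "'a \<Rightarrow> 'a \<Rightarrow> real"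
  assumes fin: "finite (set_pmf p)" "finite (set_pmf q)"
    and nonneg: "\<And>x y. 0 \<le> d x y"
    and far: "\<And>x y. x \<in> set_pmf p \<Longrightarrow> y \<in> set_pmf q \<Longrightarrow> y \<in> S \<Longrightarrow> M \<le> d x y"
  shows "M * measure_pmf.prob q S \<le> earth_movers_dist d p q"
  unfolding earth_movers_dist_def
proof (rule cINF_greatest)
  \<comment> \<open>A real infimum is bounded below in this way only over a nonempty set; the
    independent coupling is a witness.\<close>
  have "pair_pmf p q \<in> couplings p q"
    by (simp add: couplings_def map_fst_pair_pmf map_snd_pair_pmf)
  thus "couplings p q \<noteq> {}" by blast
next
  fix r assume "r \<in> couplings p q"
  hence p: "p = map_pmf fst r" and q: "q = map_pmf snd r"
    by (auto simp: couplings_def)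
  have sub: "set_pmf r \<subseteq> set_pmf p \<times> set_pmf q"
    unfolding p q set_map_pmf by force
  hence "finite (set_pmf r)"
    using fin by (meson finite_SigmaI finite_subset)
  note int = integrable_measure_pmf_finite[OF this]
  have "M * measure_pmf.prob q S = measure_pmf.expectation r (\<lambda>z. M * indicator (snd -` S) z)"
    unfolding q by simp
  also have "\<dots> \<le> measure_pmf.expectation r (\<lambda>(x, y). d x y)"
  proof (rule integral_mono_AE[OF int int])
    show "AE z in measure_pmf r. M * indicator (snd -` S) z \<le> (case z of (x, y) \<Rightarrow> d x y)"
      using sub far nonneg by (auto simp: AE_measure_pmf_iff indicator_def split: prod.splits)
  qed
  finally show "M * measure_pmf.prob q S \<le> measure_pmf.expectation r (\<lambda>(x, y). d x y)" .
qed

text \<open>Supplies the finite supports that \<open>earth_movers_dist_ge_prob\<close> asks for.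
  Colorings are extensional on \<open>V\<close>, so there are only finitely many.\<close>

lemma finite_set_pmf_two_coloring_algorithm:
  assumes "two_coloring_algorithm A" "bipartite_graph V E"
  shows "finite (set_pmf (A V E))"
proof (rule finite_subset)
  show "set_pmf (A V E) \<subseteq> V \<rightarrow>\<^sub>E {0, 1}"
    using assms unfolding two_coloring_algorithm_def proper_2_coloring_def by blast
  show "finite (V \<rightarrow>\<^sub>E {0, 1 :: nat})"
    using assms(2) by (intro finite_PiE) (auto simp: bipartite_graph_def simple_graph_def)
qed

section \<open>Hamiltonian paths and the reversal of a segment\<close>

text \<open>A Hamiltonian path is encoded by a permutation \<pi>, with \<pi> i the vertex at
  position i. For n \<ge> 2 each path arises from two permutations, one per direction, which leaves
  averages unchanged.\<close>

definition path_edge :: "(nat \<Rightarrow> nat) \<Rightarrow> nat \<Rightarrow> nat set" where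
  "path_edge \<pi> i = {\<pi> i, \<pi> (Suc i)}"

definition path_edges :: "nat \<Rightarrow> (nat \<Rightarrow> nat) \<Rightarrow> nat set set" where
  "path_edges n \<pi> = path_edge \<pi> ` {..<n - 1}"

text \<open>The reflection of the positions after k, exchanging \<open>Suc k\<close> and
  \<open>n - 1\<close>. Composed to the right of \<pi>, it reverses the second segment of the
  path.\<close>

definition reverse_after :: "nat \<Rightarrow> nat \<Rightarrow> nat \<Rightarrow> nat" where
  "reverse_after n k i = (if k < i \<and> i < n then n + k - i else i)"

lemma reverse_after_involution: "reverse_after n k \<circ> reverse_after n k = id"
  by (auto simp: reverse_after_def fun_eq_iff)

lemma reverse_after_permutes: "reverse_after n k permutes {..<n}"
proof (rule bij_imp_permutes)
  show "bij_betw (reverse_after n k) {..<n} {..<n}"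
    by (rule bij_betw_byWitness[where f' = "reverse_after n k"]) (auto simp: reverse_after_def)
qed (auto simp: reverse_after_def)

lemma inj_on_path_edge:
  assumes "\<pi> permutes S"
  shows "inj_on (path_edge \<pi>) I"
proof (rule inj_onI)
  have [simp]: "\<pi> x = \<pi> y \<longleftrightarrow> x = y" for x y
    using permutes_inj[OF assms] by (simp add: inj_eq)
  fix i j assume "path_edge \<pi> i = path_edge \<pi> j"
  thus "i = j" by (auto simp: path_edge_def doubleton_eq_iff)
qed

lemma path_edges_remove:
  assumes "\<pi> permutes S"
  shows "path_edges n \<pi> - {path_edge \<pi> k} = path_edge \<pi> ` ({..<n - 1} - {k})"
  unfolding path_edges_def
  by (subst inj_on_image_set_diff[OF inj_on_path_edge[OF assms, of UNIV]]) auto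

lemma path_edge_reverse_after_subset:
  assumes "k < n - 1"
  shows "path_edge (\<pi> \<circ> reverse_after n k) ` ({..<n - 1} - {k}) \<subseteq> path_edge \<pi> ` ({..<n - 1} - {k})"
proof (rule image_subsetI)
  fix i assume i: "i \<in> {..<n - 1} - {k}"
  show "path_edge (\<pi> \<circ> reverse_after n k) i \<in> path_edge \<pi> ` ({..<n - 1} - {k})"
  proof (cases "i < k")
    case True
    hence "path_edge (\<pi> \<circ> reverse_after n k) i = path_edge \<pi> i"
      by (simp add: path_edge_def reverse_after_def)
    thus ?thesis using i by blast
  next
    case False
    \<comment> \<open>The reflection sends i and i + 1 to two neighboring positions in reverse
      order, so the edge now starts at the image of i + 1.\<close>
    have "Suc (n + k - Suc i) = n + k - i" using i by auto
    hence "path_edge (\<pi> \<circ> reverse_after n k) i = path_edge \<pi> (n + k - Suc i)"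
      using i False by (auto simp: path_edge_def reverse_after_def)
    moreover have "n + k - Suc i \<in> {..<n - 1} - {k}" using i False by auto
    ultimately show ?thesis by blast
  qed
qed

text \<open>One inclusion is \<open>path_edge_reverse_after_subset\<close> for \<pi>; the other is
  the same lemma for \<pi>', since reversing twice gives back \<pi>.\<close>

lemma path_edges_remove_reverse_after:
  assumes \<pi>: "\<pi> permutes {..<n}" and k: "k < n - 1"
  defines "\<pi>' \<equiv> \<pi> \<circ> reverse_after n k"
  shows "path_edges n \<pi>' - {path_edge \<pi>' k} = path_edges n \<pi> - {path_edge \<pi> k}"
proof -
  have \<pi>': "\<pi>' permutes {..<n}"
    unfolding \<pi>'_def by (rule permutes_compose[OF reverse_after_permutes \<pi>])
  have "\<pi>' \<circ> reverse_after n k = \<pi>"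
    by (simp add: \<pi>'_def comp_assoc reverse_after_involution)
  thus ?thesis
    unfolding path_edges_remove[OF \<pi>] path_edges_remove[OF \<pi>']
    using path_edge_reverse_after_subset[OF k, of \<pi>] path_edge_reverse_after_subset[OF k, of \<pi>']
    by (auto simp: \<pi>'_def)
qed

text \<open>The parts are the vertices at even and at odd positions. Allowing any subset of the
  edges covers both a path and a path with an edge deleted.\<close>

lemma bipartite_graph_path_edges:
  assumes \<pi>: "\<pi> permutes {..<n}" and sub: "E \<subseteq> path_edges n \<pi>"
  shows "bipartite_graph {..<n} E"
proof -
  have inj [simp]: "\<pi> x = \<pi> y \<longleftrightarrow> x = y" for x y
    using permutes_inj[OF \<pi>] by (simp add: inj_eq)
  have lt: "\<pi> x < n \<longleftrightarrow> x < n" for x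
    using permutes_in_image[OF \<pi>, of x] by simp
  define X where "X = \<pi> ` {i. i < n \<and> even i}"
  define Y where "Y = \<pi> ` {i. i < n \<and> odd i}"
  have E: "\<exists>i. Suc i < n \<and> e = {\<pi> i, \<pi> (Suc i)}" if e: "e \<in> E" for e
  proof -
    obtain i where "i < n - 1" "e = path_edge \<pi> i"
      using sub e unfolding path_edges_def by blast
    thus ?thesis by (intro exI[of _ i]) (auto simp: path_edge_def)
  qed
  have "X \<union> Y = \<pi> ` {..<n}" unfolding X_def Y_def by auto
  hence "X \<union> Y = {..<n}" by (simp add: permutes_image[OF \<pi>])
  moreover have "X \<inter> Y = {}" by (auto simp: X_def Y_def)
  moreover have "\<forall>e\<in>E. \<exists>x\<in>X. \<exists>y\<in>Y. e = {x, y}"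
  proof
    fix e assume "e \<in> E"
    then obtain i where i: "Suc i < n" "e = {\<pi> i, \<pi> (Suc i)}" using E by blast
    show "\<exists>x\<in>X. \<exists>y\<in>Y. e = {x, y}"
    proof (cases "even i")
      case True
      hence "\<pi> i \<in> X" "\<pi> (Suc i) \<in> Y" using i by (auto simp: X_def Y_def)
      thus ?thesis using i by blast
    next
      case False
      hence "\<pi> i \<in> Y" "\<pi> (Suc i) \<in> X" using i by (auto simp: X_def Y_def)
      thus ?thesis using i by blast
    qed
  qed
  moreover have "simple_graph {..<n} E"
    unfolding simple_graph_def
  proof (intro conjI ballI)
    fix e assume "e \<in> E"
    then obtain i where "Suc i < n" "e = {\<pi> i, \<pi> (Suc i)}" using E by blast
    thus "e \<subseteq> {..<n}" "card e = 2" by (auto simp: lt)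
  qed simp
  ultimately show ?thesis unfolding bipartite_graph_def
    by (intro conjI exI[of _ X] exI[of _ Y]) assumption+
qed

section \<open>Colorings of a path with one edge deleted\<close>

lemma constant_on_interval:
  fixes P :: "nat \<Rightarrow> 'a"
  assumes "\<And>i. a \<le> i \<Longrightarrow> i < b \<Longrightarrow> P i = P (Suc i)" "a \<le> i" "i \<le> b"
  shows "P i = P a"
  using assms(2,3) by (induction i rule: dec_induct) (auto simp: assms(1)[symmetric])

lemma proper_2_coloring_path_edge:
  "proper_2_coloring V E f \<Longrightarrow> path_edge \<pi> i \<in> E \<Longrightarrow> f (\<pi> i) \<noteq> f (\<pi> (Suc i))"
  by (simp add: proper_2_coloring_def path_edge_def)

text \<open>Both colorings alternate along each of the two segments, so on a segment they agree
  everywhere or nowhere. Across the deleted edge f changes and g does not, so they disagree on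
  exactly one whole segment; the segments have \<open>Suc k\<close> and \<open>n - Suc k\<close>
  vertices.\<close>

lemma hamming_dist_path_ge:
  assumes \<pi>: "\<pi> permutes {..<n}" and k: "k < n - 1"
    and f: "proper_2_coloring {..<n} (path_edges n \<pi>) f"
    and g: "proper_2_coloring {..<n} (path_edges n \<pi> - {path_edge \<pi> k}) g"
    and eq: "g (\<pi> k) = g (\<pi> (Suc k))"
    and M: "M \<le> Suc k" "M \<le> n - Suc k"
  shows "M \<le> hamming_dist {..<n} f g"
proof -
  have val: "f (\<pi> i) \<in> {0, 1}" "g (\<pi> i) \<in> {0, 1}" if "i < n" for i
    using f g that permutes_in_image[OF \<pi>, of i] unfolding proper_2_coloring_def
    by (auto simp: PiE_iff)
  have f_step: "f (\<pi> i) \<noteq> f (\<pi> (Suc i))" if "i < n - 1" for i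
    using proper_2_coloring_path_edge[OF f] that by (simp add: path_edges_def)
  have g_step: "g (\<pi> i) \<noteq> g (\<pi> (Suc i))" if "i < n - 1" "i \<noteq> k" for i
    using proper_2_coloring_path_edge[OF g] that by (simp add: path_edges_remove[OF \<pi>])
  define D where "D i \<longleftrightarrow> f (\<pi> i) \<noteq> g (\<pi> i)" for i
  have D_step: "D i = D (Suc i)" if "i < n - 1" "i \<noteq> k" for i
  proof -
    have "i < n" "Suc i < n" using that by auto
    thus ?thesis
      using val[of i] val[of "Suc i"] f_step[of i] g_step[of i] that by (auto simp: D_def)
  qed
  have left: "D i = D 0" if "i \<le> k" for i
    by (rule constant_on_interval[of 0 k]) (use that k D_step in auto)
  have right: "D i = D (Suc k)" if "Suc k \<le> i" "i \<le> n - 1" for i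
    by (rule constant_on_interval[of "Suc k" "n - 1"]) (use that k D_step in auto)
  have "k < n" "Suc k < n" using k by auto
  hence "D k \<noteq> D (Suc k)"
    using val[of k] val[of "Suc k"] f_step[of k] k eq by (auto simp: D_def)
  \<comment> \<open>\<open>I\<close> is the segment of disagreement as a set of positions; the
    injective \<pi> then carries it to vertices.\<close>
  have "\<exists>I \<subseteq> {..<n}. M \<le> card I \<and> (\<forall>i\<in>I. D i)"
  proof (cases "D k")
    case True
    hence "\<forall>i\<in>{..k}. D i" using left by (metis atMost_iff order_refl)
    thus ?thesis using M k by (intro exI[of _ "{..k}"]) auto
  next
    case False
    with \<open>D k \<noteq> D (Suc k)\<close> have "D (Suc k)" by blast
    have "D i" if "i \<in> {Suc k..<n}" for i
      using right[of i] \<open>D (Suc k)\<close> that by (cases "i = Suc k") auto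
    hence "\<forall>i\<in>{Suc k..<n}. D i" by blast
    thus ?thesis using M k by (intro exI[of _ "{Suc k..<n}"]) auto
  qed
  then obtain I where I: "I \<subseteq> {..<n}" "M \<le> card I" "\<And>i. i \<in> I \<Longrightarrow> D i" by blast
  have "card I = card (\<pi> ` I)"
    using permutes_inj_on[OF \<pi>, of I] by (simp add: card_image)
  also have "\<dots> \<le> card {v \<in> {..<n}. f v \<noteq> g v}"
  proof (rule card_mono)
    show "\<pi> ` I \<subseteq> {v \<in> {..<n}. f v \<noteq> g v}"
      using I permutes_image[OF \<pi>] by (auto simp: D_def)
  qed simp
  finally show ?thesis using I(2) by (simp add: hamming_dist_def)
qed

text \<open>The positions \<open>Suc k\<close> (even) and \<open>n - 1\<close> (odd) are the ends of
  a segment along which g alternates.\<close>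

lemma proper_2_coloring_path_segment_ends:
  assumes \<pi>: "\<pi> permutes {..<n}" and k: "k < n - 1" "odd k" "even n"
    and g: "proper_2_coloring {..<n} (path_edges n \<pi> - {path_edge \<pi> k}) g"
  shows "g (\<pi> (Suc k)) \<noteq> g (\<pi> (n - 1))"
proof -
  have val: "g (\<pi> i) \<in> {0, 1}" if "i < n" for i
    using g that permutes_in_image[OF \<pi>, of i] unfolding proper_2_coloring_def
    by (auto simp: PiE_iff)
  have step: "g (\<pi> i) \<noteq> g (\<pi> (Suc i))" if "i < n - 1" "i \<noteq> k" for i
    using proper_2_coloring_path_edge[OF g] that by (simp add: path_edges_remove[OF \<pi>])
  \<comment> \<open>Whether the parity of the position matches the color is invariant along the
    segment, as both flip at each step.\<close>
  have "(even (n - 1) \<longleftrightarrow> g (\<pi> (n - 1)) = 0) = (even (Suc k) \<longleftrightarrow> g (\<pi> (Suc k)) = 0)"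
  proof (rule constant_on_interval[of "Suc k" "n - 1"])
    fix i assume "Suc k \<le> i" "i < n - 1"
    thus "(even i \<longleftrightarrow> g (\<pi> i) = 0) = (even (Suc i) \<longleftrightarrow> g (\<pi> (Suc i)) = 0)"
      using val[of i] val[of "Suc i"] step[of i] by auto
  qed (use k in auto)
  thus ?thesis using k by auto
qed

section \<open>The cost of deleting one edge of a path\<close>

definition removal_cost ::
    "(nat set \<Rightarrow> nat set set \<Rightarrow> (nat \<Rightarrow> nat) pmf) \<Rightarrow> nat set \<Rightarrow> nat set set \<Rightarrow> nat set \<Rightarrow> real" where
  "removal_cost A V E e =
     earth_movers_dist (\<lambda>f g. real (hamming_dist V f g)) (A V E) (A V (E - {e}))"

text \<open>By \<open>hamming_dist_path_ge\<close>, a coloring of \<open>H\<close> that gives the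
  ends of the deleted edge equal colors is far from every proper coloring of the path. The
  probability involves only the output on \<open>H\<close>, which other paths can share.\<close>

lemma removal_cost_path_ge_prob:
  assumes A: "two_coloring_algorithm A"
    and \<pi>: "\<pi> permutes {..<n}" and k: "k < n - 1"
    and M: "M \<le> Suc k" "M \<le> n - Suc k"
  defines "H \<equiv> path_edges n \<pi> - {path_edge \<pi> k}"
  shows "real M * measure_pmf.prob (A {..<n} H) {g. g (\<pi> k) = g (\<pi> (Suc k))}
           \<le> removal_cost A {..<n} (path_edges n \<pi>) (path_edge \<pi> k)"
  unfolding removal_cost_def H_def[symmetric]
proof (rule earth_movers_dist_ge_prob)
  have bip: "bipartite_graph {..<n} (path_edges n \<pi>)" "bipartite_graph {..<n} H"
    using bipartite_graph_path_edges[OF \<pi>] by (auto simp: H_def)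
  show "finite (set_pmf (A {..<n} (path_edges n \<pi>)))" "finite (set_pmf (A {..<n} H))"
    using finite_set_pmf_two_coloring_algorithm[OF A] bip by auto
  fix f g
  assume "f \<in> set_pmf (A {..<n} (path_edges n \<pi>))" "g \<in> set_pmf (A {..<n} H)"
  hence "proper_2_coloring {..<n} (path_edges n \<pi>) f" "proper_2_coloring {..<n} H g"
    using A bip unfolding two_coloring_algorithm_def by blast+
  moreover assume "g \<in> {g. g (\<pi> k) = g (\<pi> (Suc k))}"
  ultimately show "real M \<le> real (hamming_dist {..<n} f g)"
    using hamming_dist_path_ge[OF \<pi> k _ _ _ M, of f g] by (simp add: H_def)
qed simp

lemma removal_cost_nonneg:
  assumes "two_coloring_algorithm A" "bipartite_graph V E" "bipartite_graph V (E - {e})"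
  shows "0 \<le> removal_cost A V E e"
  \<comment> \<open>The instance with the empty event and \<open>M\<close> = 0.\<close>
  using earth_movers_dist_ge_prob[of "A V E" "A V (E - {e})"
      "\<lambda>f g. real (hamming_dist V f g)" "{}" 0]
    finite_set_pmf_two_coloring_algorithm[OF assms(1)] assms(2,3)
  by (simp add: removal_cost_def)

text \<open>Both paths leave the same \<open>H\<close>. The deleted edges join \<pi> k to \<pi> (Suc
  k) and to \<pi> (n - 1), whose colors differ in every coloring of \<open>H\<close>, so one of them
  has the color of \<pi> k. Thus the two bad events cover all outputs on \<open>H\<close>, and their
  probabilities sum to at least 1.\<close>

lemma removal_cost_path_reverse_after:
  assumes A: "two_coloring_algorithm A"
    and \<pi>: "\<pi> permutes {..<n}" and k: "k < n - 1" "odd k" "even n"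
    and M: "M \<le> Suc k" "M \<le> n - Suc k"
  defines "\<pi>' \<equiv> \<pi> \<circ> reverse_after n k"
  shows "real M \<le> removal_cost A {..<n} (path_edges n \<pi>) (path_edge \<pi> k)
                 + removal_cost A {..<n} (path_edges n \<pi>') (path_edge \<pi>' k)"
proof -
  have \<pi>': "\<pi>' permutes {..<n}"
    unfolding \<pi>'_def by (rule permutes_compose[OF reverse_after_permutes \<pi>])
  define H where "H = path_edges n \<pi> - {path_edge \<pi> k}"
  define q where "q = A {..<n} H"
  have H': "path_edges n \<pi>' - {path_edge \<pi>' k} = H"
    unfolding H_def \<pi>'_def by (rule path_edges_remove_reverse_after[OF \<pi> k(1)])
  let ?S = "{g. g (\<pi> k) = g (\<pi> (Suc k))}" and ?S' = "{g. g (\<pi>' k) = g (\<pi>' (Suc k))}"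
  have \<pi>'_eq: "\<pi>' k = \<pi> k" "\<pi>' (Suc k) = \<pi> (n - 1)"
    using k(1) by (auto simp: \<pi>'_def reverse_after_def)
  have "set_pmf q \<subseteq> ?S \<union> ?S'"
  proof
    fix g assume "g \<in> set_pmf q"
    moreover have "bipartite_graph {..<n} H"
      using bipartite_graph_path_edges[OF \<pi>] by (auto simp: H_def)
    ultimately have g: "proper_2_coloring {..<n} H g"
      using A by (auto simp: two_coloring_algorithm_def q_def)
    have "g (\<pi> i) \<in> {0, 1}" if "i < n" for i
      using g that permutes_in_image[OF \<pi>, of i] unfolding proper_2_coloring_def
      by (auto simp: PiE_iff)
    from this[of k] this[of "Suc k"] this[of "n - 1"]
    show "g \<in> ?S \<union> ?S'"
      using proper_2_coloring_path_segment_ends[OF \<pi> k, of g] g k(1)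
      by (auto simp: \<pi>'_eq H_def)
  qed
  hence "1 = measure_pmf.prob q (?S \<union> ?S')"
    by (intro measure_pmf.prob_eq_1[THEN iffD2, symmetric]) (auto simp: AE_measure_pmf_iff)
  also have "\<dots> \<le> measure_pmf.prob q ?S + measure_pmf.prob q ?S'"
    by (rule measure_Un_le) auto
  finally have "real M * 1 \<le> real M * (measure_pmf.prob q ?S + measure_pmf.prob q ?S')"
    by (intro mult_left_mono) auto
  also have "\<dots> \<le> removal_cost A {..<n} (path_edges n \<pi>) (path_edge \<pi> k)
                 + removal_cost A {..<n} (path_edges n \<pi>') (path_edge \<pi>' k)"
    unfolding distrib_left
    using removal_cost_path_ge_prob[OF A \<pi> k(1) M] removal_cost_path_ge_prob[OF A \<pi>' k(1) M]
    by (intro add_mono) (simp_all add: H' q_def H_def)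
  finally show ?thesis by simp
qed

section \<open>Averaging over all Hamiltonian paths\<close>

lemma average_sensitivity_eq_sum:
  assumes "finite E" "E \<noteq> {}"
  shows "average_sensitivity A V E = (\<Sum>e\<in>E. removal_cost A V E e) / real (card E)"
  unfolding average_sensitivity_def removal_cost_def[symmetric]
  by (rule integral_pmf_of_set[OF assms(2,1)])

lemma card_path_edges:
  assumes "\<pi> permutes S"
  shows "card (path_edges n \<pi>) = n - 1"
  unfolding path_edges_def by (simp add: card_image[OF inj_on_path_edge[OF assms]])

lemma average_sensitivity_path_eq:
  assumes \<pi>: "\<pi> permutes {..<n}" and n: "n \<ge> 2"
  shows "real (n - 1) * average_sensitivity A {..<n} (path_edges n \<pi>) =
           (\<Sum>k<n - 1. removal_cost A {..<n} (path_edges n \<pi>) (path_edge \<pi> k))"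
proof -
  have "finite (path_edges n \<pi>)" "path_edges n \<pi> \<noteq> {}"
    using n by (auto simp: path_edges_def lessThan_empty_iff)
  hence "real (n - 1) * average_sensitivity A {..<n} (path_edges n \<pi>) =
      (\<Sum>e\<in>path_edges n \<pi>. removal_cost A {..<n} (path_edges n \<pi>) e)"
    using n by (simp add: average_sensitivity_eq_sum card_path_edges[OF \<pi>])
  also have "\<dots> = (\<Sum>k<n - 1. removal_cost A {..<n} (path_edges n \<pi>) (path_edge \<pi> k))"
    using inj_on_path_edge[OF \<pi>] by (subst (1) path_edges_def) (simp add: sum.reindex)
  finally show ?thesis .
qed

text \<open>Right composition with \<open>reverse_after n k\<close> permutes the summation range, so
  summing the two-path bound over all \<pi> counts the total cost twice.\<close>

lemma sum_permutations_removal_cost_ge: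
  assumes A: "two_coloring_algorithm A"
    and k: "k < n - 1" "odd k" "even n" and M: "M \<le> Suc k" "M \<le> n - Suc k"
  shows "fact n * real M / 2 \<le>
    (\<Sum>\<pi> | \<pi> permutes {..<n}. removal_cost A {..<n} (path_edges n \<pi>) (path_edge \<pi> k))"
proof -
  let ?c = "\<lambda>\<pi>. removal_cost A {..<n} (path_edges n \<pi>) (path_edge \<pi> k)"
  have "fact n * real M = (\<Sum>\<pi> | \<pi> permutes {..<n}. real M)"
    by (simp add: card_permutations[of "{..<n}" n])
  also have "\<dots> \<le> (\<Sum>\<pi> | \<pi> permutes {..<n}. ?c \<pi> + ?c (\<pi> \<circ> reverse_after n k))"
    by (rule sum_mono) (use removal_cost_path_reverse_after[OF A _ k M] in auto)
  also have "\<dots> = 2 * (\<Sum>\<pi> | \<pi> permutes {..<n}. ?c \<pi>)"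
    using sum_permutations_compose_right[OF reverse_after_permutes, of ?c n k]
    by (simp add: sum.distrib)
  finally show ?thesis by simp
qed

lemma exists_path_average_sensitivity_ge:
  assumes A: "two_coloring_algorithm A" and m: "m > 0"
  shows "\<exists>\<pi>. \<pi> permutes {..<8 * m} \<and>
           average_sensitivity A {..<8 * m} (path_edges (8 * m) \<pi>) \<ge> real m / 4"
proof (rule ccontr)
  define n where "n = 8 * m"
  let ?s = "\<lambda>\<pi>. average_sensitivity A {..<n} (path_edges n \<pi>)"
  let ?c = "\<lambda>\<pi> k. removal_cost A {..<n} (path_edges n \<pi>) (path_edge \<pi> k)"
  assume "\<not> ?thesis"
  hence small: "?s \<pi> < real m / 4" if "\<pi> permutes {..<n}" for \<pi>
    using that by (auto simp: n_def not_le)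
  \<comment> \<open>The odd positions from 2m + 1 to 6m - 1. Deleting the edge at any of them leaves
    segments of at least 2m vertices, so \<open>M\<close> = 2m is admissible.\<close>
  define K where "K = (\<lambda>j. 2 * j + 1) ` {m..<3 * m}"
  have K: "K \<subseteq> {..<n - 1}" "card K = 2 * m"
    by (auto simp: K_def n_def card_image inj_on_def)
  have "fact n * (2 * real m * real m) = (\<Sum>k\<in>K. fact n * real (2 * m) / 2)"
    by (simp add: K(2))
  also have "\<dots> \<le> (\<Sum>k\<in>K. \<Sum>\<pi> | \<pi> permutes {..<n}. ?c \<pi> k)"
    by (intro sum_mono sum_permutations_removal_cost_ge[OF A]) (auto simp: K_def n_def)
  also have "\<dots> = (\<Sum>\<pi> | \<pi> permutes {..<n}. \<Sum>k\<in>K. ?c \<pi> k)"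
    by (rule sum.swap)
  \<comment> \<open>The positions outside \<open>K\<close> contribute nonnegative costs.\<close>
  also have "\<dots> \<le> (\<Sum>\<pi> | \<pi> permutes {..<n}. \<Sum>k<n - 1. ?c \<pi> k)"
    using K(1) by (intro sum_mono sum_mono2 removal_cost_nonneg[OF A] bipartite_graph_path_edges) auto
  also have "\<dots> = (\<Sum>\<pi> | \<pi> permutes {..<n}. real (n - 1) * ?s \<pi>)"
    using m by (intro sum.cong average_sensitivity_path_eq[symmetric]) (auto simp: n_def)
  also have "\<dots> \<le> (\<Sum>\<pi> | \<pi> permutes {..<n}. real (n - 1) * (real m / 4))"
    using small by (intro sum_mono mult_left_mono) (auto intro: less_imp_le)
  also have "\<dots> = fact n * (real (n - 1) * (real m / 4))"
    by (simp add: card_permutations[of "{..<n}" n])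
  \<comment> \<open>With n = 8m the right side is n! times 2m^2, exactly the lower bound at the
    start of the chain; strictness comes from n - 1 < n.\<close>
  also have "\<dots> < fact n * (real n * (real m / 4))"
    using m by (intro mult_strict_left_mono mult_strict_right_mono) (auto simp: n_def)
  finally show False by (simp add: n_def)
qed

theorem mainTheorem17:
  "\<exists>c::real. c > 0 \<and>
     (\<forall>A. two_coloring_algorithm A \<longrightarrow>
        infinite {n::nat. \<exists>V E. bipartite_graph V E \<and> card V = n \<and> E \<noteq> {} \<and>
                            average_sensitivity A V E \<ge> c * real n})"
\<comment> \<open>The bound m / 4 on 8m vertices is 1/32 of the number of vertices; the positive
  multiples of 8 serve as the infinitely many sizes.\<close>
proof (intro exI[of _ "1 / 32"] conjI allI impI)
  fix A assume A: "two_coloring_algorithm A"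
  let ?N = "{n::nat. \<exists>V E. bipartite_graph V E \<and> card V = n \<and> E \<noteq> {} \<and>
                            average_sensitivity A V E \<ge> 1 / 32 * real n}"
  have "8 * m \<in> ?N" if m: "m > 0" for m
  proof -
    obtain \<pi> where \<pi>: "\<pi> permutes {..<8 * m}"
      and s: "average_sensitivity A {..<8 * m} (path_edges (8 * m) \<pi>) \<ge> real m / 4"
      using exists_path_average_sensitivity_ge[OF A m] by blast
    have "path_edges (8 * m) \<pi> \<noteq> {}"
      using m by (auto simp: path_edges_def lessThan_empty_iff)
    thus ?thesis
      using bipartite_graph_path_edges[OF \<pi> order_refl] s
      by (intro CollectI exI[of _ "{..<8 * m}"] exI[of _ "path_edges (8 * m) \<pi>"]) auto
  qed
  hence "(\<lambda>m. 8 * m) ` {0<..} \<subseteq> ?N" by blast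
  moreover have "infinite ((\<lambda>m::nat. 8 * m) ` {0<..})"
    by (subst finite_image_iff) (auto simp: inj_on_def infinite_Ioi)
  ultimately show "infinite ?N" by (rule infinite_super)
qed simp

end
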